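(* Let $X=\sum_{i=1}^n\xi_i$, where $\xi_i\sim\mathrm{Be}(p_i)$, $i=1,\dots,n$, are independent Bernoulli random variables with success probabilities $p_i$, and let $\mu=\mathbb{E}X=\sum_{i=1}^n p_i$ and $\sigma^2=\operatorname{Var}X=\sum_{i=1}^n p_i(1-p_i)$, with $\sigma^2>0$. Then $$d_{\mathrm{TV}}\bigl(\mathscr{L}(X),\widehat{\mathrm{Bi}}(\mu,\sigma^2)\bigr)\leq\frac{1.4+0.5\sqrt{\sum_{i=1}^n(1-2p_i)^2p_i(1-p_i)}}{\sum_{i=1}^np_i(1-p_i)}.$$
   Context: $\mathscr{L}(X)$ is the law of $X$. For probability measures $P,Q$ on $\mathbb{Z}$, $d_{\mathrm{TV}}(P,Q)=\sup_{A\subset\mathbb{Z}}|P[A]-Q[A]|$. For real $x$, $\lfloor x\rfloor$ and $\lceil x\rceil$ are the floor and ceiling, and $\langle x\rangle=x-\lfloor x\rfloor$. Given $\mu\in\mathbb{R}$ and $\sigma^2>0$, let $\delta=\langle-4\sigma^2\rangle$ (so $\lceil4\sigma^2\rceil=4\sigma^2+\delta$) and $t=\langle-\mu+2\sigma^2+\delta/2\rangle/\lceil4\sigma^2\rceil$. The translated (almost) symmetric binomial distribution $\widehat{\mathrm{Bi}}(\mu,\sigma^2)$ is the binomial distribution $\mathrm{Bi}(\lceil4\sigma^2\rceil,\tfrac12-t)$ shifted by $\mu-\lceil4\sigma^2\rceil(\tfrac12-t)$, i.e. the law of $Y+\mu-\lceil4\sigma^2\rceil(\tfrac12-t)$ with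 $Y\sim\mathrm{Bi}(\lceil4\sigma^2\rceil,\tfrac12-t)$ (number of trials, success probability). The shift is an integer. The statement is understood whenever this is a genuine probability distribution, i.e. $\tfrac12-t\ge0$ (automatic if $\sigma^2>1/4$). *)

theory Defs
  imports "HOL-Probability.Probability"
begin

text \<open>
  Meant for probability measures on the integers with the discrete sigma-algebra, so that every
  \<^term>\<open>A :: int set\<close> is an event; the supremum is then over a set bounded by 1.
\<close>
definition tv_dist :: "int measure \<Rightarrow> int measure \<Rightarrow> real" where
  "tv_dist P Q = (SUP A. \<bar>measure P A - measure Q A\<bar>)"

definition tbin_trials :: "real \<Rightarrow> nat" where
  "tbin_trials s2 = nat \<lceil>4 * s2\<rceil>"

definition tbin_delta :: "real \<Rightarrow> real" where
  "tbin_delta s2 = frac (- 4 * s2)"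

definition tbin_t :: "real \<Rightarrow> real \<Rightarrow> real" where
  "tbin_t m s2 = frac (- m + 2 * s2 + tbin_delta s2 / 2) / real (tbin_trials s2)"

definition tbin_shift :: "real \<Rightarrow> real \<Rightarrow> real" where
  "tbin_shift m s2 = m - real (tbin_trials s2) * (1 / 2 - tbin_t m s2)"

text \<open>
  The shift is a real expression with an integer value (lemma \<open>tbin_shift_integer\<close> below), so the
  floor only changes its type. The success probability lies in \<open>[0, 1]\<close>, as \<^const>\<open>binomial_pmf\<close>
  requires, iff \<^prop>\<open>0 \<le> 1 / 2 - tbin_t m s2\<close>.
\<close>
definition translated_binomial_pmf :: "real \<Rightarrow> real \<Rightarrow> int pmf" where
  "translated_binomial_pmf m s2 =
     map_pmf (\<lambda>k. int k + \<lfloor>tbin_shift m s2\<rfloor>)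
       (binomial_pmf (tbin_trials s2) (1 / 2 - tbin_t m s2))"

lemma tbin_trials_eq:
  assumes "s2 > 0"
  shows "real (tbin_trials s2) = 4 * s2 + tbin_delta s2"
proof -
  have "\<lceil>4 * s2\<rceil> \<ge> 0" using assms by linarith
  then show ?thesis
    unfolding tbin_trials_def tbin_delta_def frac_def ceiling_def by simp
qed

lemma tbin_shift_integer:
  assumes "s2 > 0"
  shows "real_of_int \<lfloor>tbin_shift m s2\<rfloor> = tbin_shift m s2"
proof -
  let ?a = "- m + 2 * s2 + tbin_delta s2 / 2"
  have N: "real (tbin_trials s2) = 4 * s2 + tbin_delta s2"
    by (rule tbin_trials_eq[OF assms])
  have "tbin_delta s2 \<ge> 0" unfolding tbin_delta_def by simp
  then have pos: "real (tbin_trials s2) > 0" using N assms by linarith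
  have Nt: "real (tbin_trials s2) * tbin_t m s2 = frac ?a"
    unfolding tbin_t_def using pos by simp
  have "tbin_shift m s2 = m - real (tbin_trials s2) / 2 + frac ?a"
    unfolding tbin_shift_def Nt[symmetric] by (simp add: algebra_simps)
  also have "\<dots> = real_of_int (- \<lfloor>?a\<rfloor>)"
    unfolding N frac_def by (simp add: field_simps)
  finally have "tbin_shift m s2 = real_of_int (- \<lfloor>?a\<rfloor>)" .
  then show ?thesis by (metis floor_of_int)
qed

end

(*
  For variance at most 1.4 the bound exceeds 1. Otherwise let W be X minus the integer shift, so that
  E W = m q with m the number of trials and q = 1/2 - t, and let g solve the Stein equation
    q (m - k) g(k+1) - (1 - q) k g(k) = 1_A(k) - Bi(m,q)(A)    (0 <= k <= m).
  Exchanging the value of one summand gives E (xi_i - p_i) g(W) = E p_i (1 - xi_i) Dg(W) with Dg the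
  forward difference, and summing over i turns the Stein operator into
    E Dg(W) (m q (1 - q) - Var X + sum_i (p_i - q) (xi_i - p_i)).
  Keeping the weighted sum inside the expectation, instead of taking a second difference of g, makes
  the term with the square root appear directly from Cauchy-Schwarz and |Dg| <= 1 / Var X. The event
  that W leaves {0..m} is handled by Chebyshev's inequality.
*)
theory Submission
  imports Defs
begin

section \<open>Binomial weights: recurrences and tail estimates\<close>

definition bin_prob :: "nat \<Rightarrow> real \<Rightarrow> nat \<Rightarrow> real" where
  "bin_prob m q k = real (m choose k) * q ^ k * (1 - q) ^ (m - k)"

lemma bin_prob_nonneg: "0 \<le> q \<Longrightarrow> q \<le> 1 \<Longrightarrow> 0 \<le> bin_prob m q k"
  by (simp add: bin_prob_def)

lemma bin_prob_pos: "0 < q \<Longrightarrow> q < 1 \<Longrightarrow> k \<le> m \<Longrightarrow> 0 < bin_prob m q k"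
  by (simp add: bin_prob_def)

lemma sum_bin_prob: "(\<Sum>k\<le>m. bin_prob m q k) = 1"
  using binomial_ring[of q "1 - q" m] by (simp add: bin_prob_def)

text \<open>Detailed balance for the birth-death chain with up rate \<open>q * (m - k)\<close> and
  down rate \<open>(1 - q) * k\<close>. These rates are the two coefficients of the Stein operator,
  so this is the identity that makes the Stein equation telescope.\<close>

lemma bin_prob_balance:
  assumes "k < m"
  shows "q * (real m - real k) * bin_prob m q k
       = (1 - q) * real (Suc k) * bin_prob m q (Suc k)"
proof -
  have "Suc k * (m choose Suc k) = (m - k) * (m choose k)"
    by (metis assms binomial_absorb_comp binomial_absorption less_imp_Suc_add mult.commute nat_less_le)
  then have *: "real (Suc k) * real (m choose Suc k) = (real m - real k) * real (m choose k)"
    using assms by (metis less_imp_le of_nat_diff of_nat_mult)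
  have "(1 - q) ^ (m - k) = (1 - q) * (1 - q) ^ (m - Suc k)"
    using assms by (metis Suc_diff_Suc power_Suc)
  then have "q * (real m - real k) * bin_prob m q k
     = (q * q ^ k) * ((1 - q) * (1 - q) ^ (m - Suc k)) * ((real m - real k) * real (m choose k))"
    by (simp add: bin_prob_def)
  also have "\<dots> = (1 - q) * real (Suc k) * bin_prob m q (Suc k)"
    by (simp add: bin_prob_def flip: *)
  finally show ?thesis .
qed

text \<open>Absorption \<open>(k + 1) * C(m + 1, k + 1) = (m + 1) * C(m, k)\<close>: size-biasing
  \<open>Bi(m + 1, q)\<close> by its number of successes gives \<open>Bi(m, q)\<close> shifted up by
  one.\<close>

lemma bin_prob_Suc_trials_up:
  "real (Suc m) * q * bin_prob m q k = real (Suc k) * bin_prob (Suc m) q (Suc k)"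
proof -
  have "Suc k * (Suc m choose Suc k) = Suc m * (m choose k)"
    using Suc_times_binomial_eq[of m k] by (simp only: mult.commute)
  then have "real (Suc k) * real (Suc m choose Suc k) = real (Suc m) * real (m choose k)"
    by (metis of_nat_mult)
  then show ?thesis
    by (simp add: bin_prob_def mult.assoc mult.left_commute del: of_nat_Suc binomial_Suc_Suc)
qed

text \<open>The counterpart with failures in place of successes: here the additional trial fails, so
  \<open>k\<close> does not move.\<close>

lemma bin_prob_Suc_trials_stay:
  assumes "k \<le> m"
  shows "real (Suc m) * (1 - q) * bin_prob m q k = (real (Suc m) - real k) * bin_prob (Suc m) q k"
proof -
  have "(Suc m - k) * (Suc m choose k) = Suc m * (m choose k)"
    using binomial_absorb_comp[of "Suc m" k] by simp
  then have *: "(real (Suc m) - real k) * real (Suc m choose k) = real (Suc m) * real (m choose k)"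
    using assms by (metis le_Suc_eq of_nat_diff of_nat_mult)
  have "(1 - q) ^ (Suc m - k) = (1 - q) * (1 - q) ^ (m - k)"
    using assms by (simp add: Suc_diff_le)
  then have "(real (Suc m) - real k) * bin_prob (Suc m) q k
    = ((real (Suc m) - real k) * real (Suc m choose k)) * q ^ k * ((1 - q) * (1 - q) ^ (m - k))"
    by (simp add: bin_prob_def)
  then have "(real (Suc m) - real k) * bin_prob (Suc m) q k
    = (real (Suc m) * real (m choose k)) * q ^ k * ((1 - q) * (1 - q) ^ (m - k))"
    by (simp only: *)
  then show ?thesis by (simp only: bin_prob_def mult_ac)
qed

text \<open>Termwise from detailed balance, since \<open>m - k \<le> m - j\<close> and
  \<open>j + 1 \<le> k\<close> for \<open>j < k\<close>; the shifted sum misses only the weight at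
  0. In terms of the Stein solution, it does not increase from \<open>k\<close> to
  \<open>k + 1\<close> when the event is a single point above \<open>k\<close>.\<close>

lemma bin_prob_lower_tail:
  assumes q: "0 < q" "q < 1" and k: "k \<le> m"
  shows "q * (real m - real k) * (\<Sum>j<k. bin_prob m q j)
       \<le> (1 - q) * real k * (\<Sum>j<Suc k. bin_prob m q j)"
proof -
  have "q * (real m - real k) * (\<Sum>j<k. bin_prob m q j)
      \<le> (\<Sum>j<k. (1 - q) * real k * bin_prob m q (Suc j))"
    unfolding sum_distrib_left
  proof (rule sum_mono)
    fix j assume "j \<in> {..<k}"
    then have j: "j < k" by simp
    have "q * (real m - real k) * bin_prob m q j \<le> q * (real m - real j) * bin_prob m q j"
      using j q bin_prob_nonneg[of q m j] by (intro mult_right_mono mult_left_mono) auto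
    also have "\<dots> = (1 - q) * real (Suc j) * bin_prob m q (Suc j)"
      using j k by (intro bin_prob_balance) auto
    also have "\<dots> \<le> (1 - q) * real k * bin_prob m q (Suc j)"
      using j q bin_prob_nonneg[of q m "Suc j"] by (intro mult_right_mono mult_left_mono) auto
    finally show "q * (real m - real k) * bin_prob m q j \<le> (1 - q) * real k * bin_prob m q (Suc j)" .
  qed
  also have "\<dots> \<le> (1 - q) * real k * (\<Sum>j<Suc k. bin_prob m q j)"
    unfolding sum.lessThan_Suc_shift using q bin_prob_nonneg[of q m 0]
    by (simp add: sum_distrib_left distrib_left)
  finally show ?thesis .
qed

text \<open>The mirror image, needed for events that are a single point below
  \<open>k\<close>.\<close>

lemma bin_prob_upper_tail:
  assumes q: "0 < q" "q < 1" and k: "k \<le> m"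
  shows "(1 - q) * real k * (\<Sum>j\<in>{k<..m}. bin_prob m q j)
       \<le> q * (real m - real k) * (\<Sum>j\<in>{k..m}. bin_prob m q j)"
proof -
  have "(1 - q) * real k * (\<Sum>j\<in>{k<..m}. bin_prob m q j)
      = (\<Sum>j\<in>{k..<m}. (1 - q) * real k * bin_prob m q (Suc j))"
    unfolding sum_distrib_left
    by (rule sum.reindex_bij_witness[of _ Suc "\<lambda>j. j - 1"]) auto
  also have "\<dots> \<le> (\<Sum>j\<in>{k..<m}. q * (real m - real k) * bin_prob m q j)"
  proof (rule sum_mono)
    fix j assume j: "j \<in> {k..<m}"
    have "(1 - q) * real k * bin_prob m q (Suc j) \<le> (1 - q) * real (Suc j) * bin_prob m q (Suc j)"
      using j q bin_prob_nonneg[of q m "Suc j"] by (intro mult_right_mono mult_left_mono) auto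
    also have "\<dots> = q * (real m - real j) * bin_prob m q j"
      using j by (intro bin_prob_balance[symmetric]) auto
    also have "\<dots> \<le> q * (real m - real k) * bin_prob m q j"
      using j q bin_prob_nonneg[of q m j] by (intro mult_right_mono mult_left_mono) auto
    finally show "(1 - q) * real k * bin_prob m q (Suc j) \<le> q * (real m - real k) * bin_prob m q j" .
  qed
  also have "\<dots> \<le> (\<Sum>j\<in>{k..m}. q * (real m - real k) * bin_prob m q j)"
    using q k bin_prob_nonneg[of q m] by (intro sum_mono2) auto
  finally show ?thesis by (simp add: sum_distrib_left)
qed

text \<open>The tails are compared with those of \<open>Bi(m + 1, q)\<close>, which is what turns the
  naive factor \<open>m\<close> into \<open>m + 1\<close>.\<close>
lemma bin_prob_tails_bound:
  assumes q: "0 < q" "q < 1" and k: "0 < k" "k < m"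
  shows "(real m + 1) * q * (1 - q) *
      ((\<Sum>j\<in>{k<..m}. bin_prob m q j) / (q * (real m - real k))
        + (\<Sum>j<k. bin_prob m q j) / ((1 - q) * real k)) \<le> 1"
proof -
  let ?r = "bin_prob (Suc m) q"
  have "real (Suc m) * q * (\<Sum>j<k. bin_prob m q j) = (\<Sum>j<k. real (Suc j) * ?r (Suc j))"
    unfolding sum_distrib_left by (intro sum.cong refl bin_prob_Suc_trials_up)
  also have "\<dots> \<le> (\<Sum>j<k. real k * ?r (Suc j))"
    using q by (intro sum_mono mult_right_mono bin_prob_nonneg) auto
  finally have L: "real (Suc m) * q * (\<Sum>j<k. bin_prob m q j) / real k \<le> (\<Sum>j<k. ?r (Suc j))"
    using k by (simp add: divide_le_eq mult.commute flip: sum_distrib_left)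
  have "real (Suc m) * (1 - q) * (\<Sum>j\<in>{k<..m}. bin_prob m q j)
      = (\<Sum>j\<in>{k<..m}. (real (Suc m) - real j) * ?r j)"
    unfolding sum_distrib_left by (intro sum.cong refl bin_prob_Suc_trials_stay) auto
  also have "\<dots> \<le> (\<Sum>j\<in>{k<..m}. (real m - real k) * ?r j)"
    using q by (intro sum_mono mult_right_mono bin_prob_nonneg) auto
  finally have U: "real (Suc m) * (1 - q) * (\<Sum>j\<in>{k<..m}. bin_prob m q j) / (real m - real k)
      \<le> (\<Sum>j\<in>{k<..m}. ?r j)"
    using k by (simp add: divide_le_eq mult.commute flip: sum_distrib_left)
  \<comment> \<open>Moving the lower tail up by one places it on \<open>{1..k}\<close>, still
    disjoint from the upper tail, so both together carry at most the total mass of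
    \<open>Bi(m + 1, q)\<close>.\<close>
  have "(\<Sum>j<k. ?r (Suc j)) = sum ?r {1..k}"
    by (rule sum.reindex_bij_witness[of _ "\<lambda>j. j - 1" Suc]) auto
  moreover have "sum ?r {1..k} + sum ?r {k<..m} = sum ?r ({1..k} \<union> {k<..m})"
    by (rule sum.union_disjoint[symmetric]) auto
  moreover have "\<dots> \<le> sum ?r {..Suc m}"
    using q k by (intro sum_mono2 bin_prob_nonneg) auto
  ultimately have "(\<Sum>j<k. ?r (Suc j)) + sum ?r {k<..m} \<le> 1"
    using sum_bin_prob[of "Suc m" q] by linarith
  moreover have "(real m + 1) * q * (1 - q) * (u / (q * (real m - real k)) + l / ((1 - q) * real k))
     = real (Suc m) * (1 - q) * u / (real m - real k) + real (Suc m) * q * l / real k" for u l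
  proof -
    have "(real m + 1) * q * (1 - q) * (u / (q * (real m - real k)))
       = real (Suc m) * (1 - q) * u / (real m - real k)"
      using q k by (simp add: field_simps)
    moreover have "(real m + 1) * q * (1 - q) * (l / ((1 - q) * real k))
       = real (Suc m) * q * l / real k"
      using q k by (simp add: divide_simps)
    ultimately show ?thesis by (simp only: distrib_left)
  qed
  ultimately show ?thesis using L U by simp
qed

section \<open>The Stein equation of \<open>Bi(m, q)\<close>: its solution and the increments of the
  solution\<close>

lemma bin_prob_measure_bounds:
  assumes "0 < q" "q < 1"
  shows "0 \<le> (\<Sum>i\<le>m. bin_prob m q i * indicator A (int i))"
    and "(\<Sum>i\<le>m. bin_prob m q i * indicator A (int i)) \<le> 1"
proof -
  show "0 \<le> (\<Sum>i\<le>m. bin_prob m q i * indicator A (int i))"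
    using assms by (intro sum_nonneg mult_nonneg_nonneg bin_prob_nonneg) auto
  have "(\<Sum>i\<le>m. bin_prob m q i * indicator A (int i)) \<le> (\<Sum>i\<le>m. bin_prob m q i)"
    using assms bin_prob_nonneg[of q m] by (intro sum_mono) (auto simp: indicator_def)
  then show "(\<Sum>i\<le>m. bin_prob m q i * indicator A (int i)) \<le> 1"
    by (simp only: sum_bin_prob)
qed

text \<open>Multiply the Stein equation at \<open>k\<close> by \<open>bin_prob m q k\<close>. By
  detailed balance the left side becomes \<open>F (k + 1) - F k\<close> with
  \<open>F k = (1 - q) * k * bin_prob m q k * g k\<close> and \<open>F 0 = 0\<close>; these partial
  sums are the values that \<open>F\<close> must take.\<close>

definition bin_stein_sum :: "nat \<Rightarrow> real \<Rightarrow> int set \<Rightarrow> nat \<Rightarrow> real" where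
  "bin_stein_sum m q A k = (\<Sum>j<k. bin_prob m q j *
     (indicator A (int j) - (\<Sum>i\<le>m. bin_prob m q i * indicator A (int i))))"

text \<open>Extending the solution by zero outside \<open>{1..m}\<close> makes the Stein operator vanish
  outside \<open>{0..m}\<close>.\<close>
definition bin_stein :: "nat \<Rightarrow> real \<Rightarrow> int set \<Rightarrow> int \<Rightarrow> real" where
  "bin_stein m q A k = (if 1 \<le> k \<and> k \<le> int m
     then bin_stein_sum m q A (nat k) / ((1 - q) * k * bin_prob m q (nat k)) else 0)"

lemma bin_stein_sum_eq:
  "bin_stein_sum m q A k = (\<Sum>j<k. bin_prob m q j * indicator A (int j))
     - (\<Sum>j\<le>m. bin_prob m q j * indicator A (int j)) * (\<Sum>j<k. bin_prob m q j)"
  unfolding bin_stein_sum_def right_diff_distrib sum_subtractf sum_distrib_right[symmetric]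
  by (simp only: mult.commute)

text \<open>The centred indicator has mean zero under \<open>Bi(m, q)\<close>. This is the
  solvability condition at \<open>k = m\<close>, where the up rate vanishes.\<close>

lemma bin_stein_sum_Suc_trials: "bin_stein_sum m q A (Suc m) = 0"
  unfolding bin_stein_sum_eq lessThan_Suc_atMost sum_bin_prob by simp

text \<open>Detailed balance exchanges the denominator at \<open>k + 1\<close> for one at
  \<open>k\<close>, so both terms of the Stein operator get the denominator
  \<open>bin_prob m q k\<close>.\<close>

lemma bin_stein_up:
  assumes q: "0 < q" "q < 1" and k: "k < m"
  shows "q * (real m - real k) * bin_stein m q A (int k + 1)
     = bin_stein_sum m q A (Suc k) / bin_prob m q k"
proof -
  have n: "nat (int k + 1) = Suc k" "nat (1 + int k) = Suc k" by simp_all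
  have "bin_stein m q A (int k + 1)
     = bin_stein_sum m q A (Suc k) / ((1 - q) * real (Suc k) * bin_prob m q (Suc k))"
    using k by (simp add: bin_stein_def n add.commute)
  also have "\<dots> = bin_stein_sum m q A (Suc k) / (q * (real m - real k) * bin_prob m q k)"
    by (simp only: bin_prob_balance[OF k])
  finally have *: "bin_stein m q A (int k + 1)
     = bin_stein_sum m q A (Suc k) / (q * (real m - real k) * bin_prob m q k)" .
  have "q * (real m - real k) \<noteq> 0" using q k by simp
  then show ?thesis
    unfolding * times_divide_eq_right by (rule nonzero_mult_divide_mult_cancel_left)
qed

lemma bin_stein_down:
  assumes q: "0 < q" "q < 1" and k: "0 < k" "k \<le> m"
  shows "(1 - q) * real k * bin_stein m q A (int k) = bin_stein_sum m q A k / bin_prob m q k"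
  using assms by (simp add: bin_stein_def)

text \<open>Consecutive partial sums differ by one summand, and dividing by its weight leaves the
  centred indicator. The ends fit in because a rate and a partial sum vanish together: the down rate
  with the empty sum at 0, the up rate with the full sum at \<open>m\<close>.\<close>

lemma bin_stein_equation:
  assumes q: "0 < q" "q < 1" and k: "k \<le> m"
  shows "q * (real m - real k) * bin_stein m q A (int k + 1) - (1 - q) * real k * bin_stein m q A (int k)
     = indicator A (int k) - (\<Sum>i\<le>m. bin_prob m q i * indicator A (int i))"
proof -
  note pos = bin_prob_pos[OF q k]
  have up: "q * (real m - real k) * bin_stein m q A (int k + 1)
     = bin_stein_sum m q A (Suc k) / bin_prob m q k"
    using bin_stein_up[OF q, of k m A] bin_stein_sum_Suc_trials[of m q A] k
    by (cases "k = m") auto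
  have down: "(1 - q) * real k * bin_stein m q A (int k) = bin_stein_sum m q A k / bin_prob m q k"
    using bin_stein_down[OF q, of k m A] k by (cases "k = 0") (auto simp: bin_stein_sum_def)
  show ?thesis unfolding up down diff_divide_distrib[symmetric]
    using pos by (simp add: bin_stein_sum_def)
qed

lemma bin_stein_operator_outside:
  assumes "k < 0 \<or> k > int m"
  shows "q * (real m - real_of_int k) * bin_stein m q A (k + 1)
     - (1 - q) * real_of_int k * bin_stein m q A k = 0"
  using assms by (auto simp: bin_stein_def)

text \<open>\<open>L\<close>, \<open>p\<close>, \<open>U\<close> are the masses below, at and above
  \<open>k\<close>; \<open>a\<close> and \<open>e\<close> are the parts of the event below and
  above, \<open>c\<close> its indicator at \<open>k\<close>, and \<open>b\<close>, \<open>d\<close>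
  the up and down rates. With denominators cleared the increment is linear in \<open>a\<close>,
  \<open>c\<close>, \<open>e\<close>, with coefficients of sign minus, plus, minus. It is therefore
  largest for the event \<open>{k}\<close> and smallest for its complement.\<close>

lemma stein_increment_algebra:
  fixes a c e L p U b d :: real
  assumes sum1: "L + p + U = 1" and c: "0 \<le> c" "c \<le> 1" and a: "0 \<le> a" "a \<le> L"
    and e: "0 \<le> e" "e \<le> U" and pos: "0 < p" "0 < b" "0 < d"
    and low: "b * L \<le> d * (L + p)" and up: "d * U \<le> b * (p + U)"
  shows "\<bar>(a + p * c - (a + p * c + e) * (L + p)) / p / b - (a - (a + p * c + e) * L) / p / d\<bar>
     \<le> U / b + L / d"
proof -
  have U: "U = 1 - L - p" using sum1 by simp
  have L0: "0 \<le> L" and U0: "0 \<le> U" using a e by auto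
  let ?x = "d * U - b * (p + U)" and ?y = "b * L - d * (L + p)" and ?z = "p * (d * U + b * L)"
  have z0: "0 \<le> ?z" using pos L0 U0 by simp
  define T where "T = d * (a + p * c - (a + p * c + e) * (L + p)) - b * (a - (a + p * c + e) * L)"
  have T: "T = a * ?x + c * ?z + e * ?y"
    unfolding T_def U by (simp add: algebra_simps)
  have "T \<le> ?z"
  proof -
    have "a * ?x \<le> 0" "e * ?y \<le> 0" using a e low up by (auto intro!: mult_nonneg_nonpos)
    moreover have "c * ?z \<le> ?z" using c z0 by (simp add: mult_left_le_one_le)
    ultimately show ?thesis unfolding T by linarith
  qed
  moreover have "- ?z \<le> T"
  proof -
    have "L * ?x \<le> a * ?x" "U * ?y \<le> e * ?y"
      using a e low up by (auto intro!: mult_right_mono_neg)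
    moreover have "0 \<le> c * ?z" using c z0 by (rule_tac mult_nonneg_nonneg)
    \<comment> \<open>An event and its complement have opposite increments, so the lower extreme is
      the negative of the upper one.\<close>
    moreover have "L * ?x + U * ?y = - ?z" by (simp add: algebra_simps)
    ultimately show ?thesis unfolding T by linarith
  qed
  ultimately have "\<bar>T\<bar> \<le> ?z" by simp
  then have "\<bar>T\<bar> / (p * b * d) \<le> ?z / (p * b * d)"
    using pos by (intro divide_right_mono) auto
  also have "?z / (p * b * d) = U / b + L / d" using pos by (simp add: field_simps)
  also have "\<bar>T\<bar> / (p * b * d) = \<bar>T / (p * b * d)\<bar>" using pos by simp
  also have "T / (p * b * d) = (a + p * c - (a + p * c + e) * (L + p)) / p / b
      - (a - (a + p * c + e) * L) / p / d"
    unfolding T_def using pos by (simp add: diff_divide_distrib)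
  finally show ?thesis .
qed

text \<open>The extreme event \<open>{k}\<close> has increment \<open>U / ?b + L / ?d\<close>, which
  the comparison with \<open>m + 1\<close> trials controls uniformly in \<open>k\<close>.\<close>

lemma bin_stein_increment_inside:
  assumes q: "0 < q" "q < 1" and k: "0 < k" "k < m"
  shows "\<bar>bin_stein m q A (int k + 1) - bin_stein m q A (int k)\<bar> \<le> 1 / ((real m + 1) * q * (1 - q))"
proof -
  let ?b = "q * (real m - real k)" and ?d = "(1 - q) * real k"
  let ?i = "\<lambda>j. indicator A (int j) :: real"
  let ?w = "\<lambda>j. bin_prob m q j * ?i j"
  define L U p a e where "L = (\<Sum>j<k. bin_prob m q j)" and "U = (\<Sum>j\<in>{k<..m}. bin_prob m q j)"
    and "p = bin_prob m q k" and "a = (\<Sum>j<k. ?w j)" and "e = (\<Sum>j\<in>{k<..m}. ?w j)"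
  have pos: "0 < p" "0 < ?b" "0 < ?d" using q k bin_prob_pos[OF q, of k m] by (auto simp: p_def)
  have split: "sum f {..m} = sum f {..<k} + f k + sum f {k<..m}" for f :: "nat \<Rightarrow> real"
  proof -
    have "sum f {..m} = sum f {..<Suc k} + sum f {k<..m}"
      using k by (subst sum.union_disjoint[symmetric]) (auto intro!: sum.cong)
    then show ?thesis by simp
  qed
  have split': "sum f {k..m} = f k + sum f {k<..m}" for f :: "nat \<Rightarrow> real"
    using k by (simp add: sum.head)
  have w: "0 \<le> ?w j" "?w j \<le> bin_prob m q j" for j
    using bin_prob_nonneg[of q m j] q by (auto simp: indicator_def)
  have S: "bin_stein_sum m q A (Suc k) = a + p * ?i k - (a + p * ?i k + e) * (L + p)"
    "bin_stein_sum m q A k = a - (a + p * ?i k + e) * L"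
    unfolding bin_stein_sum_eq split sum.lessThan_Suc L_def a_def p_def e_def by (rule refl)+
  have g1: "bin_stein m q A (int k + 1) = (a + p * ?i k - (a + p * ?i k + e) * (L + p)) / p / ?b"
  proof (rule eq_divide_imp)
    show "bin_stein m q A (int k + 1) * ?b = (a + p * ?i k - (a + p * ?i k + e) * (L + p)) / p"
      using bin_stein_up[OF q k(2), of A] by (simp only: S p_def mult.commute)
  qed (use q k in simp)
  have g0: "bin_stein m q A (int k) = (a - (a + p * ?i k + e) * L) / p / ?d"
  proof (rule eq_divide_imp)
    show "bin_stein m q A (int k) * ?d = (a - (a + p * ?i k + e) * L) / p"
      using bin_stein_down[OF q k(1), of m A] k by (simp only: S p_def mult.commute less_imp_le)
  qed (use q k in simp)
  have "\<bar>bin_stein m q A (int k + 1) - bin_stein m q A (int k)\<bar> \<le> U / ?b + L / ?d"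
    unfolding g1 g0
  proof (rule stein_increment_algebra)
    show "L + p + U = 1"
      using split[of "bin_prob m q"] sum_bin_prob[of m q] by (simp add: L_def U_def p_def)
    show "0 \<le> ?i k" "?i k \<le> 1" by (auto simp: indicator_def)
    show "0 \<le> a" "a \<le> L" "0 \<le> e" "e \<le> U"
      unfolding a_def L_def e_def U_def by (intro sum_nonneg sum_mono w)+
    show "?b * L \<le> ?d * (L + p)"
      using bin_prob_lower_tail[OF q, of k m] k by (simp add: L_def p_def)
    show "?d * U \<le> ?b * (p + U)"
      using bin_prob_upper_tail[OF q, of k m] k by (simp add: U_def p_def split')
  qed (fact pos)+
  also have "\<dots> \<le> 1 / ((real m + 1) * q * (1 - q))"
    using bin_prob_tails_bound[OF q k] q
    by (simp add: U_def L_def pos_le_divide_eq mult.commute)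
  finally show ?thesis .
qed

text \<open>At \<open>k = 0\<close> and \<open>k = m\<close> one of the two values is zero by
  convention, and the Stein equation bounds the other by the reciprocal of the remaining rate. This
  is the source of the second and third conditions on \<open>K\<close>.\<close>

lemma bin_stein_increment_bound:
  assumes q: "0 < q" "q < 1" and m: "0 < m"
    and K: "1 / ((real m + 1) * q * (1 - q)) \<le> K" "1 / (q * real m) \<le> K" "1 / ((1 - q) * real m) \<le> K"
  shows "\<bar>bin_stein m q A (k + 1) - bin_stein m q A k\<bar> \<le> K"
proof -
  let ?P = "\<Sum>i\<le>m. bin_prob m q i * indicator A (int i)"
  have P: "\<bar>indicator A j - ?P\<bar> \<le> 1" for j
    using bin_prob_measure_bounds[OF q, of m A] by (auto simp: indicator_def)
  have bd: "\<bar>y\<bar> \<le> K" if "\<bar>x * y\<bar> \<le> 1" "0 < x" "1 / x \<le> K" for x y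
  proof -
    have "\<bar>y\<bar> \<le> 1 / x" using that by (simp add: abs_mult field_simps)
    then show ?thesis using that by simp
  qed
  have "0 \<le> 1 / (q * real m)" using q by simp
  then have K0: "0 \<le> K" using K(2) by linarith
  consider "k < 0 \<or> k > int m" | "k = 0" | "k = int m" | "0 < k" "k < int m" by linarith
  then show ?thesis
  proof cases
    case 1
    then show ?thesis using K0 by (auto simp: bin_stein_def)
  next
    case 2
    have "q * real m * bin_stein m q A 1 = indicator A 0 - ?P"
      using bin_stein_equation[OF q, of 0 m A] by simp
    then have "\<bar>bin_stein m q A 1\<bar> \<le> K"
      using P[of 0] q m K(2) by (intro bd[of "q * real m"]) auto
    then show ?thesis using 2 by (simp add: bin_stein_def)
  next
    case 3
    have "(1 - q) * real m * bin_stein m q A (int m) = - (indicator A (int m) - ?P)"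
      using bin_stein_equation[OF q, of m m A] by simp
    then have "\<bar>(1 - q) * real m * bin_stein m q A (int m)\<bar> \<le> 1"
      using P[of "int m"] by (simp only: abs_minus_cancel)
    then have "\<bar>bin_stein m q A (int m)\<bar> \<le> K"
      using q m K(3) by (intro bd[of "(1 - q) * real m"]) auto
    then show ?thesis using 3 by (simp add: bin_stein_def)
  next
    case 4
    then obtain j where "k = int j" "0 < j" "j < m" by (metis of_nat_0_less_iff of_nat_less_iff zero_less_imp_eq_int)
    then show ?thesis using bin_stein_increment_inside[OF q, of j m A] K(1) by simp
  qed
qed

text \<open>Finite support gives a crude bound. Its size is irrelevant, since it only secures
  integrability.\<close>

lemma bin_stein_bounded: "\<exists>B. \<forall>k. \<bar>bin_stein m q A k\<bar> \<le> B"
proof (intro exI allI)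
  fix k
  show "\<bar>bin_stein m q A k\<bar> \<le> (\<Sum>j\<in>{1..int m}. \<bar>bin_stein m q A j\<bar>)"
  proof (cases "k \<in> {1..int m}")
    case True
    then show ?thesis by (intro member_le_sum) auto
  next
    case False
    then have "bin_stein m q A k = 0" by (auto simp: bin_stein_def)
    then show ?thesis by (simp add: sum_nonneg)
  qed
qed

section \<open>Sums of independent Bernoulli variables and their Stein identity\<close>

lemma abs_integral_le:
  fixes f g :: "'a \<Rightarrow> real"
  assumes f: "integrable M f" and g: "integrable M g"
    and le: "\<And>x. x \<in> space M \<Longrightarrow> \<bar>f x\<bar> \<le> g x"
  shows "\<bar>integral\<^sup>L M f\<bar> \<le> integral\<^sup>L M g"
proof -
  have "\<bar>integral\<^sup>L M f\<bar> \<le> (\<integral>x. \<bar>f x\<bar> \<partial>M)" by (rule integral_abs_bound)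
  also have "\<dots> \<le> integral\<^sup>L M g" using f g le by (intro integral_mono) auto
  finally show ?thesis .
qed

locale bernoulli_sum = prob_space M for M :: "'w measure" +
  fixes I :: "'i set" and p :: "'i \<Rightarrow> real" and \<xi> :: "'i \<Rightarrow> 'w \<Rightarrow> int"
  assumes fin: "finite I"
    and p01: "\<And>i. i \<in> I \<Longrightarrow> 0 \<le> p i \<and> p i \<le> 1"
    and indep: "indep_vars (\<lambda>_. count_space UNIV) \<xi> I"
    and bernoulli: "\<And>i. i \<in> I \<Longrightarrow>
      distr M (count_space UNIV) (\<xi> i) = measure_pmf (map_pmf of_bool (bernoulli_pmf (p i)))"
begin

definition total :: "'w \<Rightarrow> int" where
  "total \<omega> = (\<Sum>i\<in>I. \<xi> i \<omega>)"

lemma measurable_summand: "i \<in> I \<Longrightarrow> \<xi> i \<in> measurable M (count_space UNIV)"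
  using indep by (auto simp: indep_vars_def)

lemma measurable_partial_sum [measurable]:
  "J \<subseteq> I \<Longrightarrow> (\<lambda>\<omega>. \<Sum>j\<in>J. \<xi> j \<omega>) \<in> measurable M (count_space UNIV)"
proof (induction J rule: infinite_finite_induct)
  case (insert j J)
  have [measurable]: "\<xi> j \<in> measurable M (count_space UNIV)"
    "(\<lambda>\<omega>. \<Sum>j\<in>J. \<xi> j \<omega>) \<in> measurable M (count_space UNIV)"
    using insert measurable_summand[of j] by auto
  have "(\<lambda>\<omega>. \<xi> j \<omega> + (\<Sum>j\<in>J. \<xi> j \<omega>)) \<in> measurable M (count_space UNIV)"
    by measurable
  then show ?case using insert by simp
qed auto

lemma measurable_total [measurable]: "total \<in> measurable M (count_space UNIV)"
  unfolding total_def[abs_def] by (rule measurable_partial_sum) simp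

text \<open>Only the law of \<open>\<xi> i\<close> is prescribed, so the values 0 and 1 are
  guaranteed up to a null set and no more.\<close>

lemma AE_summand: "i \<in> I \<Longrightarrow> AE \<omega> in M. \<xi> i \<omega> \<in> {0, 1}"
proof -
  assume i: "i \<in> I"
  have "AE x in distr M (count_space UNIV) (\<xi> i). x \<in> {0, 1}"
    unfolding bernoulli[OF i] by (auto simp: AE_measure_pmf_iff)
  then show ?thesis using AE_distrD[OF measurable_summand[OF i]] by simp
qed

lemma expectation_summand: "i \<in> I \<Longrightarrow> expectation (\<lambda>\<omega>. f (\<xi> i \<omega>)) = p i * f 1 + (1 - p i) * f 0"
  for f :: "int \<Rightarrow> real"
proof -
  assume i: "i \<in> I"
  have "expectation (\<lambda>\<omega>. f (\<xi> i \<omega>)) = integral\<^sup>L (distr M (count_space UNIV) (\<xi> i)) f"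
    using measurable_summand[OF i] by (subst integral_distr) auto
  also have "\<dots> = p i * f 1 + (1 - p i) * f 0"
    unfolding bernoulli[OF i] using p01[OF i] by (simp add: integral_map_pmf)
  finally show ?thesis .
qed

lemma integrable_summand: "i \<in> I \<Longrightarrow> integrable M (\<lambda>\<omega>. real_of_int (\<xi> i \<omega>))"
  using AE_summand[of i] measurable_summand[of i]
  by (intro integrable_const_bound[where B = 1]) (auto elim!: eventually_mono)

lemma integrable_bounded_total:
  fixes h :: "int \<Rightarrow> real"
  assumes "\<And>k. \<bar>h k\<bar> \<le> B"
  shows "integrable M (\<lambda>\<omega>. h (total \<omega>))"
  using assms by (intro integrable_const_bound[where B = B]) auto

lemma integrable_summand_bounded_total:
  fixes h :: "int \<Rightarrow> real"
  assumes h: "\<And>k. \<bar>h k\<bar> \<le> B" and i: "i \<in> I"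
  shows "integrable M (\<lambda>\<omega>. real_of_int (\<xi> i \<omega>) * h (total \<omega>))"
proof -
  note [measurable] = measurable_summand[OF i]
  have "0 \<le> B" using h[of 0] by linarith
  then show ?thesis
    using AE_summand[OF i] h
    by (intro integrable_const_bound[where B = B]) (auto elim!: eventually_mono)
qed

text \<open>Given the other summands, both sides equal \<open>p i * (1 - p i)\<close> times \<open>h\<close> evaluated at one plus
  their sum.\<close>
lemma summand_exchange:
  fixes h :: "int \<Rightarrow> real"
  assumes h: "\<And>k. \<bar>h k\<bar> \<le> B" and i: "i \<in> I"
  shows "(1 - p i) * expectation (\<lambda>\<omega>. real_of_int (\<xi> i \<omega>) * h (total \<omega>))
       = p i * expectation (\<lambda>\<omega>. (1 - real_of_int (\<xi> i \<omega>)) * h (total \<omega> + 1))"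
proof -
  define R where "R \<omega> = (\<Sum>j\<in>I - {i}. \<xi> j \<omega>)" for \<omega>
  have R: "total \<omega> = \<xi> i \<omega> + R \<omega>" for \<omega>
    unfolding total_def R_def using i fin by (simp add: sum.remove)
  have [measurable]: "R \<in> measurable M (count_space UNIV)"
    unfolding R_def[abs_def] by (rule measurable_partial_sum) auto
  note [measurable] = measurable_summand[OF i]
  have "indep_vars (\<lambda>_. borel) (\<lambda>j \<omega>. real_of_int (\<xi> j \<omega>)) I"
    by (rule indep_vars_compose2[OF indep]) auto
  then have "indep_vars (\<lambda>_. borel) (\<lambda>j \<omega>. real_of_int (\<xi> j \<omega>)) (insert i (I - {i}))"
    using i by (simp add: insert_absorb)
  from indep_vars_sum[OF _ _ this]
  have "indep_var borel (\<lambda>\<omega>. real_of_int (\<xi> i \<omega>)) borel (\<lambda>\<omega>. \<Sum>j\<in>I - {i}. real_of_int (\<xi> j \<omega>))"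
    using fin by auto
  then have iv: "indep_var borel (\<lambda>\<omega>. real_of_int (\<xi> i \<omega>)) borel (\<lambda>\<omega>. real_of_int (R \<omega>))"
    by (simp add: R_def)
  \<comment> \<open>The remaining sum is treated as a real variable here; the floor recovers the
    integer at which \<open>h\<close> is evaluated.\<close>
  have "indep_var borel ((\<lambda>x. x) \<circ> (\<lambda>\<omega>. real_of_int (\<xi> i \<omega>))) borel ((\<lambda>x. h (\<lfloor>x\<rfloor> + 1)) \<circ> (\<lambda>\<omega>. real_of_int (R \<omega>)))"
    by (rule indep_var_compose[OF iv]) measurable
  then have ind: "indep_var borel (\<lambda>\<omega>. real_of_int (\<xi> i \<omega>)) borel (\<lambda>\<omega>. h (R \<omega> + 1))"
    by (simp add: o_def)
  have hi: "integrable M (\<lambda>\<omega>. h (R \<omega> + 1))"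
    using h by (intro integrable_const_bound[where B = B]) auto
  have prod: "expectation (\<lambda>\<omega>. real_of_int (\<xi> i \<omega>) * h (R \<omega> + 1)) = p i * expectation (\<lambda>\<omega>. h (R \<omega> + 1))"
    and prod_int: "integrable M (\<lambda>\<omega>. real_of_int (\<xi> i \<omega>) * h (R \<omega> + 1))"
    using indep_var_lebesgue_integral[OF ind integrable_summand[OF i] hi]
      indep_var_integrable[OF ind integrable_summand[OF i] hi] expectation_summand[OF i, of real_of_int]
    by simp_all
  \<comment> \<open>The factor \<open>\<xi> i\<close> survives only where
    \<open>total = R + 1\<close>. In the next identity \<open>1 - \<xi> i\<close> survives only
    where \<open>total = R\<close>, so there too \<open>h\<close> is evaluated at
    \<open>R + 1\<close>.\<close>
  have "expectation (\<lambda>\<omega>. real_of_int (\<xi> i \<omega>) * h (total \<omega>))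
      = expectation (\<lambda>\<omega>. real_of_int (\<xi> i \<omega>) * h (R \<omega> + 1))"
    using AE_summand[OF i] by (intro integral_cong_AE) (auto elim!: eventually_mono simp: R add.commute)
  moreover have "expectation (\<lambda>\<omega>. (1 - real_of_int (\<xi> i \<omega>)) * h (total \<omega> + 1))
      = expectation (\<lambda>\<omega>. h (R \<omega> + 1) - real_of_int (\<xi> i \<omega>) * h (R \<omega> + 1))"
    using AE_summand[OF i] by (intro integral_cong_AE) (auto elim!: eventually_mono simp: R)
  moreover have "\<dots> = (1 - p i) * expectation (\<lambda>\<omega>. h (R \<omega> + 1))"
    using hi prod_int by (simp add: prod left_diff_distrib)
  ultimately show ?thesis by (simp add: prod)
qed

text \<open>Write \<open>\<xi> i - p i\<close> as
  \<open>(1 - p i) * \<xi> i - p i * (1 - \<xi> i)\<close>. The exchange identity turns the first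
  part into \<open>p i * (1 - \<xi> i)\<close> times the shifted value of \<open>h\<close>, which
  leaves a forward difference.\<close>

lemma summand_stein_identity:
  fixes h :: "int \<Rightarrow> real"
  assumes h: "\<And>k. \<bar>h k\<bar> \<le> B" and i: "i \<in> I"
  shows "expectation (\<lambda>\<omega>. (real_of_int (\<xi> i \<omega>) - p i) * h (total \<omega>))
     = expectation (\<lambda>\<omega>. p i * (1 - real_of_int (\<xi> i \<omega>)) * (h (total \<omega> + 1) - h (total \<omega>)))"
proof -
  have h': "\<bar>h (k + 1)\<bar> \<le> B" for k by (rule h)
  note int = integrable_bounded_total[of h, OF h] integrable_bounded_total[of "\<lambda>k. h (k + 1)", OF h']
    integrable_summand_bounded_total[of h, OF h i]
    integrable_summand_bounded_total[of "\<lambda>k. h (k + 1)", OF h' i]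
  from summand_exchange[of h, OF h i] show ?thesis
    using int by (simp add: algebra_simps)
qed

lemma stein_identity:
  fixes h :: "int \<Rightarrow> real"
  assumes h: "\<And>k. \<bar>h k\<bar> \<le> B"
  shows "expectation (\<lambda>\<omega>. (real_of_int (total \<omega>) - sum p I) * h (total \<omega>))
     = expectation (\<lambda>\<omega>. (h (total \<omega> + 1) - h (total \<omega>)) * (\<Sum>i\<in>I. p i * (1 - real_of_int (\<xi> i \<omega>))))"
proof -
  have h': "\<bar>h (k + 1)\<bar> \<le> B" for k by (rule h)
  note int = integrable_bounded_total[of h, OF h] integrable_bounded_total[of "\<lambda>k. h (k + 1)", OF h']
    integrable_summand_bounded_total[of h, OF h]
    integrable_summand_bounded_total[of "\<lambda>k. h (k + 1)", OF h']
  have "expectation (\<lambda>\<omega>. (real_of_int (total \<omega>) - sum p I) * h (total \<omega>))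
      = expectation (\<lambda>\<omega>. \<Sum>i\<in>I. (real_of_int (\<xi> i \<omega>) - p i) * h (total \<omega>))"
    by (simp add: total_def sum_subtractf flip: sum_distrib_right)
  also have "\<dots> = (\<Sum>i\<in>I. expectation (\<lambda>\<omega>. (real_of_int (\<xi> i \<omega>) - p i) * h (total \<omega>)))"
    using int by (intro Bochner_Integration.integral_sum) (auto simp: left_diff_distrib)
  also have "\<dots> = (\<Sum>i\<in>I. expectation (\<lambda>\<omega>. p i * (1 - real_of_int (\<xi> i \<omega>)) * (h (total \<omega> + 1) - h (total \<omega>))))"
    by (rule sum.cong[OF refl summand_stein_identity[of h, OF h]])
  also have "\<dots> = expectation (\<lambda>\<omega>. \<Sum>i\<in>I. p i * (1 - real_of_int (\<xi> i \<omega>)) * (h (total \<omega> + 1) - h (total \<omega>)))"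
    using int by (intro Bochner_Integration.integral_sum[symmetric]) (auto simp: algebra_simps)
  finally show ?thesis
    by (simp add: mult.commute flip: sum_distrib_right)
qed

section \<open>Second moments, deviations and mean absolute values of weighted centred sums\<close>

lemma integrable_centered_mult:
  assumes "i \<in> I" "j \<in> I"
  shows "integrable M (\<lambda>\<omega>. (real_of_int (\<xi> i \<omega>) - p i) * (real_of_int (\<xi> j \<omega>) - p j))"
proof -
  have "AE \<omega> in M. norm ((real_of_int (\<xi> i \<omega>) - p i) * (real_of_int (\<xi> j \<omega>) - p j)) \<le> 1 * 1"
    using AE_summand[OF assms(1)] AE_summand[OF assms(2)]
  proof eventually_elim
    case (elim \<omega>)
    then show ?case using p01[OF assms(1)] p01[OF assms(2)]
      unfolding norm_mult by (intro mult_mono) auto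
  qed
  then show ?thesis
    using measurable_summand[OF assms(1)] measurable_summand[OF assms(2)]
    by (intro integrable_const_bound) auto
qed

lemma expectation_centered_mult:
  assumes i: "i \<in> I" and j: "j \<in> I"
  shows "expectation (\<lambda>\<omega>. (real_of_int (\<xi> i \<omega>) - p i) * (real_of_int (\<xi> j \<omega>) - p j))
    = (if i = j then p i * (1 - p i) else 0)"
proof (cases "i = j")
  case True
  show ?thesis
    using expectation_summand[OF i, of "\<lambda>x. (real_of_int x - p i) * (real_of_int x - p i)"] True
    by (simp add: algebra_simps)
next
  case False
  have "indep_vars (\<lambda>_. borel) (\<lambda>j \<omega>. real_of_int (\<xi> j \<omega>) - p j) I"
    by (rule indep_vars_compose2[OF indep]) auto
  then have "indep_vars (\<lambda>_. borel) (\<lambda>j \<omega>. real_of_int (\<xi> j \<omega>) - p j) (insert i {j})"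
    by (rule indep_vars_subset) (use i j in auto)
  from indep_vars_sum[OF _ _ this]
  have "indep_var borel (\<lambda>\<omega>. real_of_int (\<xi> i \<omega>) - p i) borel (\<lambda>\<omega>. real_of_int (\<xi> j \<omega>) - p j)"
    using False by simp
  from indep_var_lebesgue_integral[OF this] show ?thesis
    using integrable_summand[OF i] integrable_summand[OF j]
      expectation_summand[OF i, of "\<lambda>x. real_of_int x - p i"] False
    by (simp add: algebra_simps)
qed

text \<open>Weights 1 give the variance of the total; weights \<open>p i - q\<close> give the
  fluctuation term of the Stein estimate.\<close>

lemma
  shows integrable_weighted_square: "integrable M (\<lambda>\<omega>. (\<Sum>i\<in>I. a i * (real_of_int (\<xi> i \<omega>) - p i))\<^sup>2)"
    and expectation_weighted_square: "expectation (\<lambda>\<omega>. (\<Sum>i\<in>I. a i * (real_of_int (\<xi> i \<omega>) - p i))\<^sup>2)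
      = (\<Sum>i\<in>I. (a i)\<^sup>2 * (p i * (1 - p i)))"
proof -
  have sq: "(\<Sum>i\<in>I. a i * (real_of_int (\<xi> i \<omega>) - p i))\<^sup>2
    = (\<Sum>i\<in>I. \<Sum>j\<in>I. (a i * a j) * ((real_of_int (\<xi> i \<omega>) - p i) * (real_of_int (\<xi> j \<omega>) - p j)))" for \<omega>
    by (simp add: power2_eq_square sum_product mult_ac)
  show "integrable M (\<lambda>\<omega>. (\<Sum>i\<in>I. a i * (real_of_int (\<xi> i \<omega>) - p i))\<^sup>2)"
    unfolding sq by (intro Bochner_Integration.integrable_sum integrable_mult_right integrable_centered_mult)
  have "expectation (\<lambda>\<omega>. (\<Sum>i\<in>I. a i * (real_of_int (\<xi> i \<omega>) - p i))\<^sup>2)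
     = (\<Sum>i\<in>I. \<Sum>j\<in>I. (a i * a j) * (if i = j then p i * (1 - p i) else 0))"
    unfolding sq
    by (subst Bochner_Integration.integral_sum, intro Bochner_Integration.integrable_sum
        integrable_mult_right integrable_centered_mult, assumption+, rule sum.cong, rule refl,
        subst Bochner_Integration.integral_sum, intro integrable_mult_right integrable_centered_mult,
        assumption+, rule sum.cong, rule refl)
      (simp add: expectation_centered_mult)
  also have "\<dots> = (\<Sum>i\<in>I. (a i)\<^sup>2 * (p i * (1 - p i)))"
    using fin by (simp add: power2_eq_square if_distrib[of "(*) _"] cong: if_cong)
  finally show "expectation (\<lambda>\<omega>. (\<Sum>i\<in>I. a i * (real_of_int (\<xi> i \<omega>) - p i))\<^sup>2)
      = (\<Sum>i\<in>I. (a i)\<^sup>2 * (p i * (1 - p i)))" .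
qed

lemma expectation_total: "expectation (\<lambda>\<omega>. real_of_int (total \<omega>)) = sum p I"
proof -
  have "expectation (\<lambda>\<omega>. real_of_int (total \<omega>)) = (\<Sum>i\<in>I. expectation (\<lambda>\<omega>. real_of_int (\<xi> i \<omega>)))"
    unfolding total_def of_int_sum by (intro Bochner_Integration.integral_sum integrable_summand)
  also have "\<dots> = sum p I" by (intro sum.cong) (simp_all add: expectation_summand)
  finally show ?thesis .
qed

text \<open>The factor 1 is kept so that the right side is literally a weighted sum.\<close>

lemma centered_total: "real_of_int (total \<omega>) - sum p I = (\<Sum>i\<in>I. 1 * (real_of_int (\<xi> i \<omega>) - p i))"
  by (simp add: total_def sum_subtractf)

lemma variance_total: "variance (\<lambda>\<omega>. real_of_int (total \<omega>)) = (\<Sum>i\<in>I. p i * (1 - p i))"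
  unfolding expectation_total centered_total expectation_weighted_square by simp

lemma total_deviation:
  assumes "0 < r"
  shows "prob {\<omega>\<in>space M. r \<le> \<bar>real_of_int (total \<omega>) - sum p I\<bar>} \<le> (\<Sum>i\<in>I. p i * (1 - p i)) / r\<^sup>2"
proof -
  have int: "integrable M (\<lambda>\<omega>. (real_of_int (total \<omega>) - sum p I)\<^sup>2)"
    unfolding centered_total by (rule integrable_weighted_square)
  \<comment> \<open>Chebyshev's inequality asks for an integrable uncentred square, which is rebuilt
    from the centred square and a linear term.\<close>
  have "integrable M (\<lambda>\<omega>. real_of_int (total \<omega>))"
    unfolding total_def of_int_sum by (intro Bochner_Integration.integrable_sum integrable_summand)
  then have "integrable M (\<lambda>\<omega>. (real_of_int (total \<omega>) - sum p I)\<^sup>2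
      + 2 * sum p I * real_of_int (total \<omega>) - (sum p I)\<^sup>2)"
    using int by simp
  also have "(\<lambda>\<omega>. (real_of_int (total \<omega>) - sum p I)\<^sup>2
      + 2 * sum p I * real_of_int (total \<omega>) - (sum p I)\<^sup>2) = (\<lambda>\<omega>. (real_of_int (total \<omega>))\<^sup>2)"
    by (simp add: fun_eq_iff power2_eq_square algebra_simps)
  finally show ?thesis
    using Chebyshev_inequality[of "\<lambda>\<omega>. real_of_int (total \<omega>)" r] assms
    by (simp add: variance_total[unfolded expectation_total] expectation_total)
qed

text \<open>Cauchy-Schwarz, in the form that the variance of the absolute value is
  nonnegative.\<close>

lemma expectation_abs_weighted_le:
  "expectation (\<lambda>\<omega>. \<bar>\<Sum>i\<in>I. a i * (real_of_int (\<xi> i \<omega>) - p i)\<bar>)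
    \<le> sqrt (\<Sum>i\<in>I. (a i)\<^sup>2 * (p i * (1 - p i)))"
proof -
  let ?V = "\<lambda>\<omega>. \<Sum>i\<in>I. a i * (real_of_int (\<xi> i \<omega>) - p i)"
  have int: "integrable M (\<lambda>\<omega>. \<bar>?V \<omega>\<bar>)"
    by (intro integrable_abs Bochner_Integration.integrable_sum integrable_mult_right
        Bochner_Integration.integrable_diff integrable_summand) auto
  have "variance (\<lambda>\<omega>. \<bar>?V \<omega>\<bar>) = expectation (\<lambda>\<omega>. (?V \<omega>)\<^sup>2) - (expectation (\<lambda>\<omega>. \<bar>?V \<omega>\<bar>))\<^sup>2"
    using variance_eq[OF int] integrable_weighted_square[of a] by simp
  then have "(expectation (\<lambda>\<omega>. \<bar>?V \<omega>\<bar>))\<^sup>2 \<le> (\<Sum>i\<in>I. (a i)\<^sup>2 * (p i * (1 - p i)))"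
    using variance_positive[of "\<lambda>\<omega>. \<bar>?V \<omega>\<bar>"] unfolding expectation_weighted_square by linarith
  then show ?thesis by (rule real_le_rsqrt)
qed

section \<open>Comparison of the shifted sum with a binomial law of the same mean\<close>

lemma binomial_approximation:
  assumes q: "0 < q" "q < 1" and m: "0 < m"
    and K: "1 / ((real m + 1) * q * (1 - q)) \<le> K" "1 / (q * real m) \<le> K" "1 / ((1 - q) * real m) \<le> K"
    and mean: "sum p I - real_of_int s = real m * q"
  shows "\<bar>prob {\<omega>\<in>space M. total \<omega> - s \<in> A} - (\<Sum>i\<le>m. bin_prob m q i * indicator A (int i))\<bar>
    \<le> K * (\<bar>real m * q * (1 - q) - (\<Sum>i\<in>I. p i * (1 - p i))\<bar>
        + sqrt (\<Sum>i\<in>I. (p i - q)\<^sup>2 * (p i * (1 - p i))))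
      + prob {\<omega>\<in>space M. total \<omega> - s < 0 \<or> total \<omega> - s > int m}"
proof -
  define P where "P = (\<Sum>i\<le>m. bin_prob m q i * indicator A (int i))"
  define v where "v = (\<Sum>i\<in>I. p i * (1 - p i))"
  \<comment> \<open>Translating the solution by \<open>s\<close> makes
    \<open>h (total \<omega>)\<close> its value at \<open>W \<omega>\<close>, and \<open>T\<close>
    below the Stein operator at \<open>W\<close>.\<close>
  define h where "h k = bin_stein m q A (k - s)" for k
  define D where "D k = h (k + 1) - h k" for k
  define W where "W \<omega> = real_of_int (total \<omega> - s)" for \<omega>
  define V where "V \<omega> = (\<Sum>i\<in>I. (p i - q) * (real_of_int (\<xi> i \<omega>) - p i))" for \<omega>
  define Z where "Z \<omega> = (\<Sum>i\<in>I. p i * (1 - real_of_int (\<xi> i \<omega>)))" for \<omega>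
  define T where "T \<omega> = q * (real m - W \<omega>) * h (total \<omega> + 1) - (1 - q) * W \<omega> * h (total \<omega>)" for \<omega>
  let ?in = "{\<omega>\<in>space M. total \<omega> - s \<in> A}"
  let ?out = "{\<omega>\<in>space M. total \<omega> - s < 0 \<or> total \<omega> - s > int m}"

  obtain B where B: "\<And>k. \<bar>h k\<bar> \<le> B"
    using bin_stein_bounded[of m q A] by (auto simp: h_def)
  have D: "\<bar>D k\<bar> \<le> K" for k
    using bin_stein_increment_bound[OF q m K, of A "k - s"] by (simp add: D_def h_def algebra_simps)
  have K0: "0 \<le> K" using D[of 0] by linarith

  have int_D: "integrable M (\<lambda>\<omega>. D (total \<omega>))"
    by (rule integrable_bounded_total[OF D])
  have int_xiD: "integrable M (\<lambda>\<omega>. real_of_int (\<xi> i \<omega>) * D (total \<omega>))" if "i \<in> I" for i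
    by (rule integrable_summand_bounded_total[OF D that])
  have "D (total \<omega>) * Z \<omega> = (\<Sum>i\<in>I. p i * (D (total \<omega>) - real_of_int (\<xi> i \<omega>) * D (total \<omega>)))" for \<omega>
    by (simp add: Z_def sum_distrib_left algebra_simps)
  then have int_DZ: "integrable M (\<lambda>\<omega>. D (total \<omega>) * Z \<omega>)"
    using int_D int_xiD by simp
  have int_Wf: "integrable M (\<lambda>\<omega>. W \<omega> * f (total \<omega>))" if "\<And>k. \<bar>f k\<bar> \<le> C" for f C
  proof -
    have "W \<omega> * f (total \<omega>) = (\<Sum>i\<in>I. real_of_int (\<xi> i \<omega>) * f (total \<omega>)) - s * f (total \<omega>)" for \<omega>
      by (simp add: W_def total_def left_diff_distrib flip: sum_distrib_right)
    then show ?thesis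
      using integrable_bounded_total[of f, OF that] integrable_summand_bounded_total[of f, OF that]
      by simp
  qed
  have center: "real_of_int (total \<omega>) - sum p I = W \<omega> - real m * q" for \<omega>
    using mean by (simp add: W_def)
  have int_center: "integrable M (\<lambda>\<omega>. (real_of_int (total \<omega>) - sum p I) * h (total \<omega>))"
    unfolding center left_diff_distrib
    using int_Wf[of h, OF B] integrable_bounded_total[of h, OF B] by simp
  have int_WD: "integrable M (\<lambda>\<omega>. q * (real m - W \<omega>) * D (total \<omega>))"
    using int_Wf[of D, OF D] int_D by (simp add: algebra_simps)
  have int_V: "integrable M (\<lambda>\<omega>. \<bar>V \<omega>\<bar>)"
    unfolding V_def by (intro integrable_abs Bochner_Integration.integrable_sum integrable_mult_right
        Bochner_Integration.integrable_diff integrable_summand) auto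

  \<comment> \<open>Once the forward difference is split off, \<open>h\<close> has the coefficient
    \<open>q * (m - W) - (1 - q) * W = m * q - W\<close>. As the means agree, this is minus the
    centred total, to which the Stein identity applies.\<close>
  have T: "T \<omega> = q * (real m - W \<omega>) * D (total \<omega>) - (real_of_int (total \<omega>) - sum p I) * h (total \<omega>)" for \<omega>
    unfolding center by (simp add: T_def D_def algebra_simps)
  have int_T: "integrable M T"
    unfolding T[abs_def] using int_WD int_center by simp
  \<comment> \<open>The deterministic part is the gap between the two variances. The random part
    collects \<open>p i\<close> from \<open>Z\<close> and \<open>- q\<close> from the up rate, hence
    the weights \<open>p i - q\<close>.\<close>
  have V: "q * (real m - W \<omega>) - Z \<omega> = real m * q * (1 - q) - v + V \<omega>" for \<omega>
  proof -
    have "(\<Sum>i\<in>I. real_of_int (\<xi> i \<omega>)) = W \<omega> + s"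
      by (simp add: W_def total_def)
    then have "q * (\<Sum>i\<in>I. real_of_int (\<xi> i \<omega>)) - q * sum p I = q * W \<omega> - q * (real m * q)"
      using mean by (simp add: algebra_simps)
    moreover have "V \<omega> = (\<Sum>i\<in>I. p i * (real_of_int (\<xi> i \<omega>) - p i))
        - (q * (\<Sum>i\<in>I. real_of_int (\<xi> i \<omega>)) - q * sum p I)"
      by (simp add: V_def left_diff_distrib right_diff_distrib sum_subtractf sum_distrib_left)
    moreover have "Z \<omega> = v - (\<Sum>i\<in>I. p i * (real_of_int (\<xi> i \<omega>) - p i))"
      by (simp add: Z_def v_def right_diff_distrib sum_subtractf)
    ultimately show ?thesis by (simp add: algebra_simps)
  qed
  have DV: "D (total \<omega>) * (real m * q * (1 - q) - v + V \<omega>)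
      = q * (real m - W \<omega>) * D (total \<omega>) - D (total \<omega>) * Z \<omega>" for \<omega>
    unfolding V[symmetric] by (simp add: algebra_simps)
  have "expectation T = expectation (\<lambda>\<omega>. q * (real m - W \<omega>) * D (total \<omega>)) - expectation (\<lambda>\<omega>. D (total \<omega>) * Z \<omega>)"
    unfolding T[abs_def] using int_WD int_center stein_identity[of h, OF B]
    by (simp add: D_def Z_def)
  also have "\<dots> = expectation (\<lambda>\<omega>. D (total \<omega>) * (real m * q * (1 - q) - v + V \<omega>))"
    using int_WD int_DZ by (simp add: DV)
  also have "\<bar>\<dots>\<bar> \<le> expectation (\<lambda>\<omega>. K * (\<bar>real m * q * (1 - q) - v\<bar> + \<bar>V \<omega>\<bar>))"
  proof (rule abs_integral_le)
    show "integrable M (\<lambda>\<omega>. D (total \<omega>) * (real m * q * (1 - q) - v + V \<omega>))"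
      using int_WD int_DZ by (simp add: DV)
    show "integrable M (\<lambda>\<omega>. K * (\<bar>real m * q * (1 - q) - v\<bar> + \<bar>V \<omega>\<bar>))"
      using int_V by simp
    show "\<bar>D (total \<omega>) * (real m * q * (1 - q) - v + V \<omega>)\<bar> \<le> K * (\<bar>real m * q * (1 - q) - v\<bar> + \<bar>V \<omega>\<bar>)" for \<omega>
      unfolding abs_mult using D K0 by (intro mult_mono) auto
  qed
  also have "\<dots> = K * (\<bar>real m * q * (1 - q) - v\<bar> + expectation (\<lambda>\<omega>. \<bar>V \<omega>\<bar>))"
    using int_V by (simp add: prob_space)
  also have "\<dots> \<le> K * (\<bar>real m * q * (1 - q) - v\<bar> + sqrt (\<Sum>i\<in>I. (p i - q)\<^sup>2 * (p i * (1 - p i))))"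
    using K0 expectation_abs_weighted_le[of "\<lambda>i. p i - q"]
    by (intro mult_left_mono add_left_mono) (auto simp: V_def)
  finally have ET: "\<bar>expectation T\<bar> \<le> K * (\<bar>real m * q * (1 - q) - v\<bar>
      + sqrt (\<Sum>i\<in>I. (p i - q)\<^sup>2 * (p i * (1 - p i))))" .

  have in_out: "?in \<in> sets M" "?out \<in> sets M"
    using measurable_sets[OF measurable_total, of "{k. k - s \<in> A}"]
      measurable_sets[OF measurable_total, of "{k. k - s < 0 \<or> k - s > int m}"]
    by (simp_all add: vimage_def Int_def conj_commute)
  have int_in: "integrable M (indicator ?in :: _ \<Rightarrow> real)"
    using in_out(1) by (rule integrable_real_indicator) (simp add: emeasure_eq_measure)
  \<comment> \<open>On \<open>{0..m}\<close> the Stein equation is exact. Outside, \<open>T\<close>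
    is zero, and the difference of an indicator and a probability is at most 1 in absolute
    value.\<close>
  have "\<bar>expectation (\<lambda>\<omega>. indicator ?in \<omega> - P - T \<omega>)\<bar> \<le> expectation (indicator ?out)"
  proof (rule abs_integral_le)
    show "integrable M (\<lambda>\<omega>. indicator ?in \<omega> - P - T \<omega>)"
      by (intro Bochner_Integration.integrable_diff int_in int_T integrable_const)
    show "integrable M (indicator ?out :: _ \<Rightarrow> real)"
      using in_out(2) by (rule integrable_real_indicator) (simp add: emeasure_eq_measure)
    fix \<omega> assume \<omega>: "\<omega> \<in> space M"
    show "\<bar>indicator ?in \<omega> - P - T \<omega>\<bar> \<le> indicator ?out \<omega>"
    proof (cases "\<omega> \<in> ?out")
      case True
      then have "T \<omega> = 0"
        using bin_stein_operator_outside[of "total \<omega> - s" m q A]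
        by (simp add: T_def W_def h_def algebra_simps)
      then show ?thesis
        using True bin_prob_measure_bounds[OF q, of m A] by (auto simp: P_def indicator_def)
    next
      case False
      then obtain k where k: "total \<omega> - s = int k" "k \<le> m"
        using \<omega> by (metis (mono_tags, lifting) mem_Collect_eq not_less of_nat_le_iff zero_le_imp_eq_int)
      have step: "total \<omega> + 1 - s = int k + 1" using k by simp
      have "T \<omega> = indicator A (int k) - P"
        using bin_stein_equation[OF q k(2), of A] by (simp only: T_def W_def h_def k step P_def of_int_of_nat_eq)
      then show ?thesis using \<omega> k by (simp add: indicator_def)
    qed
  qed
  then have "\<bar>prob ?in - P - expectation T\<bar> \<le> prob ?out"
    using int_T int_in in_out by (simp add: prob_space)
  then show ?thesis using ET by (simp add: P_def v_def)
qed

end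

section \<open>Parameters of the translated binomial law and the resulting error terms\<close>

lemma sqrt_shifted_skewness_le:
  fixes p :: "'i \<Rightarrow> real"
  assumes p: "\<And>i. i \<in> I \<Longrightarrow> 0 \<le> p i \<and> p i \<le> 1" and t: "0 \<le> t"
  shows "sqrt (\<Sum>i\<in>I. (p i - (1/2 - t))\<^sup>2 * (p i * (1 - p i)))
    \<le> t * sqrt (\<Sum>i\<in>I. p i * (1 - p i)) + 1/2 * sqrt (\<Sum>i\<in>I. (1 - 2 * p i)\<^sup>2 * p i * (1 - p i))"
proof -
  define r where "r i = sqrt (p i * (1 - p i))" for i
  have r: "(r i)\<^sup>2 = p i * (1 - p i)" if "i \<in> I" for i
    using p[OF that] by (simp add: r_def)
  \<comment> \<open>With \<open>r i\<close> the standard deviation of summand \<open>i\<close>, the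
    weight \<open>p i - (1/2 - t)\<close> splits as \<open>t - (1 - 2 * p i) / 2\<close>, and
    Minkowski's inequality separates the two parts.\<close>
  have split: "t * r i + (-1/2) * ((1 - 2 * p i) * r i) = (p i - (1/2 - t)) * r i" for i
    by (simp add: algebra_simps)
  have "sqrt (\<Sum>i\<in>I. (p i - (1/2 - t))\<^sup>2 * (p i * (1 - p i)))
      = L2_set (\<lambda>i. t * r i + (-1/2) * ((1 - 2 * p i) * r i)) I"
    unfolding L2_set_def split by (intro arg_cong[where f = sqrt] sum.cong refl)
      (simp add: r power_mult_distrib)
  also have "\<dots> \<le> L2_set (\<lambda>i. t * r i) I + L2_set (\<lambda>i. (-1/2) * ((1 - 2 * p i) * r i)) I"
    by (rule L2_set_triangle_ineq)
  also have "L2_set (\<lambda>i. t * r i) I = t * L2_set r I"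
    using t by (rule L2_set_right_distrib[symmetric])
  also have "L2_set (\<lambda>i. (-1/2) * ((1 - 2 * p i) * r i)) I = L2_set (\<lambda>i. 1/2 * ((1 - 2 * p i) * r i)) I"
    by (simp add: L2_set_def power2_eq_square)
  also have "\<dots> = 1/2 * L2_set (\<lambda>i. (1 - 2 * p i) * r i) I"
    by (rule L2_set_right_distrib[symmetric]) simp
  also have "L2_set r I = sqrt (\<Sum>i\<in>I. p i * (1 - p i))"
    unfolding L2_set_def by (intro arg_cong[where f = sqrt] sum.cong refl r)
  also have "L2_set (\<lambda>i. (1 - 2 * p i) * r i) I = sqrt (\<Sum>i\<in>I. (1 - 2 * p i)\<^sup>2 * p i * (1 - p i))"
    unfolding L2_set_def by (intro arg_cong[where f = sqrt] sum.cong refl)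
      (simp add: power_mult_distrib r)
  finally show ?thesis .
qed

lemma measure_translated_binomial_pmf:
  assumes "0 \<le> 1/2 - tbin_t \<mu> v" "1/2 - tbin_t \<mu> v \<le> 1"
  shows "measure (measure_pmf (translated_binomial_pmf \<mu> v)) A
    = (\<Sum>i\<le>tbin_trials v. bin_prob (tbin_trials v) (1/2 - tbin_t \<mu> v) i
        * indicator {k. k + \<lfloor>tbin_shift \<mu> v\<rfloor> \<in> A} (int i))"
proof -
  have "measure (measure_pmf (translated_binomial_pmf \<mu> v)) A
     = measure_pmf.expectation (binomial_pmf (tbin_trials v) (1/2 - tbin_t \<mu> v))
         (indicator ((\<lambda>k. int k + \<lfloor>tbin_shift \<mu> v\<rfloor>) -` A))"
    by (simp add: translated_binomial_pmf_def)
  also have "\<dots> = (\<Sum>i\<le>tbin_trials v. bin_prob (tbin_trials v) (1/2 - tbin_t \<mu> v) i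
        * indicator ((\<lambda>k. int k + \<lfloor>tbin_shift \<mu> v\<rfloor>) -` A) i)"
    using assms by (subst expectation_binomial_pmf') (auto simp: bin_prob_def)
  finally show ?thesis by (simp add: indicator_def)
qed

text \<open>The product of the number of trials and \<open>tbin_t\<close> is a fractional part by
  construction.\<close>

lemma tbin_t_bounds:
  assumes "0 < v"
  shows "0 \<le> tbin_t \<mu> v" "real (tbin_trials v) * tbin_t \<mu> v < 1"
proof -
  have "0 \<le> tbin_delta v" by (simp add: tbin_delta_def)
  then have "0 < real (tbin_trials v)" using tbin_trials_eq[OF assms] assms by linarith
  then show "real (tbin_trials v) * tbin_t \<mu> v < 1" "0 \<le> tbin_t \<mu> v"
    by (simp_all add: tbin_t_def frac_lt_1)
qed

lemma tv_dist_le: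
  assumes "\<And>A. \<bar>measure P A - measure Q A\<bar> \<le> c"
  shows "tv_dist P Q \<le> c"
  unfolding tv_dist_def by (rule cSUP_least) (use assms in auto)

text \<open>Since \<open>m t < 1\<close> and \<open>m\<close> exceeds \<open>4 v\<close> by less than one, the variance of \<open>Bi(m, 1/2 - t)\<close> is
  within \<open>1/4\<close> of \<open>v\<close>.\<close>
lemma tbin_numeric_bounds:
  fixes m t v \<delta> :: real
  assumes m: "m = 4 * v + \<delta>" and \<delta>: "0 \<le> \<delta>" "\<delta> < 1" and t: "0 \<le> t" "m * t < 1"
    and v: "1.4 < v" and m6: "6 \<le> m"
  shows "0 < 1/2 - t" "1 / ((m + 1) * (1/2 - t) * (1 - (1/2 - t))) \<le> 1 / v"
    and "1 / ((1/2 - t) * m) \<le> 1 / v" "1 / ((1 - (1/2 - t)) * m) \<le> 1 / v"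
    and "\<bar>m * (1/2 - t) * (1 - (1/2 - t)) - v\<bar> \<le> 1/4" "t * sqrt v \<le> 1/4" "v / (m/2)\<^sup>2 \<le> 1 / (4 * v)"
proof -
  have t6: "t < 1/6" using t m6 mult_right_mono[OF m6 t(1)] by linarith
  then show pos: "0 < 1/2 - t" by simp
  have mtt: "0 \<le> m * t * t" "m * t * t \<le> 1/6" "t * t \<le> 1/36"
    using t t6 m6 mult_mono[of "m * t" 1 t "1/6"] mult_mono[of t "1/6" t "1/6"] by auto
  have qq: "(1/2 - t) * (1 - (1/2 - t)) = 1/4 - t * t" by (simp add: algebra_simps)
  \<comment> \<open>The additional trial contributes 1/4, more than the losses
    \<open>m * t * t \<le> 1/6\<close> and \<open>t * t \<le> 1/36\<close> combined.\<close>
  have "v \<le> (m + 1) * (1/4 - t * t)" using mtt m \<delta> by (simp add: algebra_simps)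
  then show "1 / ((m + 1) * (1/2 - t) * (1 - (1/2 - t))) \<le> 1 / v"
    using v m6 mtt unfolding mult.assoc qq by (intro divide_left_mono mult_pos_pos) auto
  \<comment> \<open>The right side exceeds \<open>2 * v - 1\<close> because
    \<open>m * t < 1\<close>, and \<open>v > 1\<close>.\<close>
  have "v \<le> (1/2 - t) * m" using t m \<delta> v by (simp add: algebra_simps)
  then show "1 / ((1/2 - t) * m) \<le> 1 / v"
    using v m6 pos by (intro divide_left_mono mult_pos_pos) auto
  have "v \<le> (1 - (1/2 - t)) * m" using t m \<delta> v m6 mult_nonneg_nonneg[of t m] by (simp add: algebra_simps)
  then show "1 / ((1 - (1/2 - t)) * m) \<le> 1 / v"
    using v m6 t by (intro divide_left_mono mult_pos_pos) auto
  have "m * (1/2 - t) * (1 - (1/2 - t)) = m / 4 - m * t * t"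
    unfolding mult.assoc qq by (simp add: algebra_simps)
  then show "\<bar>m * (1/2 - t) * (1 - (1/2 - t)) - v\<bar> \<le> 1/4" using mtt m \<delta> by linarith
  \<comment> \<open>From \<open>4 * v \<le> m\<close> and \<open>m * t < 1\<close> follows
    \<open>v * t \<le> 1/4\<close>, and \<open>sqrt v \<le> v\<close> because
    \<open>v > 1\<close>.\<close>
  have "4 * v * t \<le> m * t" using m \<delta> t by (intro mult_right_mono) auto
  then have "v * t \<le> 1/4" using t by simp
  moreover have "sqrt v \<le> v" using v by (intro real_le_lsqrt) (auto simp: power2_eq_square)
  then have "t * sqrt v \<le> v * t" using t by (simp add: mult.commute mult_left_mono)
  ultimately show "t * sqrt v \<le> 1/4" by linarith
  have "(2 * v)\<^sup>2 \<le> (m / 2)\<^sup>2" using m \<delta> v by (intro power_mono) auto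
  then have "v / (m/2)\<^sup>2 \<le> v / (2 * v)\<^sup>2" using v by (intro divide_left_mono mult_pos_pos) auto
  then show "v / (m/2)\<^sup>2 \<le> 1 / (4 * v)" using v by (simp add: power2_eq_square)
qed

context bernoulli_sum
begin

lemma translated_binomial_approximation:
  defines "\<mu> \<equiv> sum p I" and "v \<equiv> \<Sum>i\<in>I. p i * (1 - p i)"
  assumes v: "1.4 < v"
  shows "\<bar>prob {\<omega>\<in>space M. total \<omega> \<in> A} - measure (measure_pmf (translated_binomial_pmf \<mu> v)) A\<bar>
    \<le> (1.4 + 0.5 * sqrt (\<Sum>i\<in>I. (1 - 2 * p i)\<^sup>2 * p i * (1 - p i))) / v"
proof -
  define m t s where "m = tbin_trials v" and "t = tbin_t \<mu> v" and "s = \<lfloor>tbin_shift \<mu> v\<rfloor>"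
  define q where "q = 1/2 - t"
  define S where "S = sqrt (\<Sum>i\<in>I. (1 - 2 * p i)\<^sup>2 * p i * (1 - p i))"
  have v0: "0 < v" using v by simp
  have m_eq: "real m = 4 * v + tbin_delta v" unfolding m_def by (rule tbin_trials_eq[OF v0])
  have \<delta>: "0 \<le> tbin_delta v" "tbin_delta v < 1" by (simp_all add: tbin_delta_def frac_lt_1)
  have t: "0 \<le> t" "real m * t < 1" using tbin_t_bounds[OF v0] by (simp_all add: m_def t_def)
  \<comment> \<open>\<open>4 * v > 5.6\<close>, so the integer \<open>m\<close> is at least 6, which
    forces \<open>t < 1/6\<close>.\<close>
  have "5 < real m" using m_eq \<delta> v by linarith
  then have m6: "6 \<le> real m" by simp
  note num = tbin_numeric_bounds[OF m_eq \<delta> t v m6, folded q_def]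
  have q: "0 < q" "q < 1" "q \<le> 1/2" using num(1) t by (simp_all add: q_def)
  \<comment> \<open>The shift is an integer, so its floor loses nothing and the means match
    exactly.\<close>
  have "real_of_int s = sum p I - real m * q"
    unfolding s_def tbin_shift_integer[OF v0] by (simp add: tbin_shift_def m_def q_def t_def \<mu>_def)
  then have mean: "sum p I - real_of_int s = real m * q" by simp
  \<comment> \<open>The mean \<open>m * q\<close> lies in the interval from \<open>m / 2 - 1\<close>
    to \<open>m / 2\<close>. A value that leaves \<open>{0..m}\<close> overshoots by at least one,
    which makes up for this offset on either side.\<close>
  have far: "real m / 2 \<le> \<bar>real_of_int k - sum p I\<bar>" if "k - s < 0 \<or> k - s > int m" for k
  proof -
    have "real_of_int (k - s) \<le> -1 \<or> real_of_int (k - s) \<ge> real m + 1" using that by linarith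
    moreover have "real m * q = real m / 2 - real m * t" by (simp add: q_def right_diff_distrib)
    moreover have "0 \<le> real m * t" using t by simp
    ultimately show ?thesis using mean t(2) by linarith
  qed
  have "prob {\<omega>\<in>space M. total \<omega> - s < 0 \<or> total \<omega> - s > int m}
     \<le> prob {\<omega>\<in>space M. real m / 2 \<le> \<bar>real_of_int (total \<omega>) - sum p I\<bar>}"
    using far by (intro finite_measure_mono) auto
  also have "\<dots> \<le> v / (real m / 2)\<^sup>2" unfolding v_def using m6 by (intro total_deviation) simp
  also have "\<dots> \<le> 1 / (4 * v)" by (rule num(7))
  finally have out: "prob {\<omega>\<in>space M. total \<omega> - s < 0 \<or> total \<omega> - s > int m} \<le> 1 / (4 * v)" .
  have "sqrt (\<Sum>i\<in>I. (p i - q)\<^sup>2 * (p i * (1 - p i))) \<le> t * sqrt v + 1/2 * S"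
    unfolding q_def v_def S_def by (rule sqrt_shifted_skewness_le[OF p01 t(1)])
  then have "1 / v * (\<bar>real m * q * (1 - q) - v\<bar> + sqrt (\<Sum>i\<in>I. (p i - q)\<^sup>2 * (p i * (1 - p i))))
      \<le> 1 / v * (1/2 + 1/2 * S)"
    using num(5,6) v0 by (intro mult_left_mono) auto
  moreover have "prob {\<omega>\<in>space M. total \<omega> - s \<in> {k. k + s \<in> A}} = prob {\<omega>\<in>space M. total \<omega> \<in> A}"
    by simp
  moreover have "measure (measure_pmf (translated_binomial_pmf \<mu> v)) A
      = (\<Sum>i\<le>m. bin_prob m q i * indicator {k. k + s \<in> A} (int i))"
    using q measure_translated_binomial_pmf[of \<mu> v A] by (simp add: m_def q_def t_def s_def)
  moreover have "0 < m" using m6 by simp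
  ultimately have "\<bar>prob {\<omega>\<in>space M. total \<omega> \<in> A} - measure (measure_pmf (translated_binomial_pmf \<mu> v)) A\<bar>
      \<le> 1 / v * (1/2 + 1/2 * S) + 1 / (4 * v)"
    using binomial_approximation[OF q(1,2) _ num(2-4) mean, of "{k. k + s \<in> A}"] out
    unfolding v_def[symmetric] by simp
  \<comment> \<open>The variance gap, the offset \<open>t\<close> and the exit probability cost
    \<open>1 / (4 * v)\<close> each, in all 0.75 over \<open>v\<close>. The larger 1.4 is the
    threshold up to which the bound is trivial.\<close>
  also have "\<dots> \<le> (1.4 + 0.5 * S) / v"
    using v0 by (simp add: field_simps)
  finally show ?thesis unfolding S_def .
qed

end

theorem theorem1p6:
  fixes M :: "'w measure" and n :: nat and p :: "nat \<Rightarrow> real"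
    and \<xi> :: "nat \<Rightarrow> 'w \<Rightarrow> int" and X :: "'w \<Rightarrow> int" and \<mu> \<sigma>2 :: real
  assumes M: "prob_space M"
    and p: "\<And>i. i \<in> {1..n} \<Longrightarrow> 0 \<le> p i \<and> p i \<le> 1"
    and indep: "prob_space.indep_vars M (\<lambda>_. count_space UNIV) \<xi> {1..n}"
    and bernoulli: "\<And>i. i \<in> {1..n} \<Longrightarrow>
      distr M (count_space UNIV) (\<xi> i) = measure_pmf (map_pmf of_bool (bernoulli_pmf (p i)))"
    and X: "X = (\<lambda>\<omega>. \<Sum>i=1..n. \<xi> i \<omega>)"
    and mean: "\<mu> = prob_space.expectation M (\<lambda>\<omega>. real_of_int (X \<omega>))"
    and var: "\<sigma>2 = prob_space.variance M (\<lambda>\<omega>. real_of_int (X \<omega>))"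
    and var_pos: "\<sigma>2 > 0"
    and genuine: "1 / 2 - tbin_t \<mu> \<sigma>2 \<ge> 0"
  shows "tv_dist (distr M (count_space UNIV) X) (measure_pmf (translated_binomial_pmf \<mu> \<sigma>2))
    \<le> (1.4 + 0.5 * sqrt (\<Sum>i=1..n. (1 - 2 * p i)\<^sup>2 * p i * (1 - p i)))
        / (\<Sum>i=1..n. p i * (1 - p i))"
proof (rule tv_dist_le)
  fix A :: "int set"
  interpret bernoulli_sum M "{1..n}" p \<xi>
    using M p indep bernoulli by (intro bernoulli_sum.intro bernoulli_sum_axioms.intro) auto
  have X_total: "X = total" unfolding X total_def[abs_def] ..
  have \<mu>: "\<mu> = sum p {1..n}" using expectation_total by (simp add: mean X_total)
  have v: "\<sigma>2 = (\<Sum>i=1..n. p i * (1 - p i))" using variance_total by (simp add: var X_total)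
  have law: "measure (distr M (count_space UNIV) X) A = prob {\<omega>\<in>space M. total \<omega> \<in> A}"
    unfolding X_total by (subst measure_distr[OF measurable_total]) (auto intro: arg_cong[where f = prob])
  show "\<bar>measure (distr M (count_space UNIV) X) A - measure (measure_pmf (translated_binomial_pmf \<mu> \<sigma>2)) A\<bar>
    \<le> (1.4 + 0.5 * sqrt (\<Sum>i=1..n. (1 - 2 * p i)\<^sup>2 * p i * (1 - p i)))
        / (\<Sum>i=1..n. p i * (1 - p i))"
  proof (cases "1.4 < \<sigma>2")
    case True
    then show ?thesis using translated_binomial_approximation[of A] unfolding law \<mu> v by blast
  next
    case False
    \<comment> \<open>For small variance the numerator is at least 1.4 and hence at least the
      denominator, while two probabilities never differ by more than 1.\<close>
    have "1 \<le> (1.4 + 0.5 * S) / \<sigma>2" if "0 \<le> S" for S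
      using False var_pos that by simp
    moreover have "0 \<le> sqrt (\<Sum>i=1..n. (1 - 2 * p i)\<^sup>2 * p i * (1 - p i))"
      using p by (intro real_sqrt_ge_zero sum_nonneg mult_nonneg_nonneg) auto
    ultimately have "1 \<le> (1.4 + 0.5 * sqrt (\<Sum>i=1..n. (1 - 2 * p i)\<^sup>2 * p i * (1 - p i))) / \<sigma>2"
      by blast
    moreover have "\<bar>prob {\<omega>\<in>space M. total \<omega> \<in> A}
        - measure (measure_pmf (translated_binomial_pmf \<mu> \<sigma>2)) A\<bar> \<le> 1"
      using prob_le_1 measure_nonneg[of M "{\<omega>\<in>space M. total \<omega> \<in> A}"]
        measure_pmf.prob_le_1[of "translated_binomial_pmf \<mu> \<sigma>2" A]
        measure_nonneg[of "measure_pmf (translated_binomial_pmf \<mu> \<sigma>2)" A]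
      by (smt (verit))
    ultimately show ?thesis unfolding law v by linarith
  qed
qed

end
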